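(* For any $n\ge1$ and any pattern pair $p\in\{(001,010),(001,011),(001,012)\}$, we have $|\mathbf{I}_n(p)|=n$.
   Context: An inversion sequence of length $n$ is an integer sequence $e=(e_1,\dots,e_n)$ with $0\le e_i\le i-1$ for all $1\le i\le n$. A word $w_1\cdots w_n$ avoids a pattern $P=p_1\cdots p_k$ if there are no $i_1<\cdots<i_k$ such that $w_{i_1}\cdots w_{i_k}$ is order isomorphic to $P$ (equal letters of $P$ corresponding to equal entries). For a pair $p=(P_1,P_2)$ of patterns, $\mathbf{I}_n(p)$ denotes the set of inversion sequences of length $n$ avoiding both $P_1$ and $P_2$. *)

theory Defs
  imports Main "HOL-Library.Sublist"
begin

(* Lists are indexed from 0, so the bound 0 <= e_i <= i - 1 for 1 <= i <= n
   becomes e ! i <= i for i < n. *)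
definition inversion_seq :: "nat list \<Rightarrow> bool" where
  "inversion_seq e \<longleftrightarrow> (\<forall>i < length e. e ! i \<le> i)"

definition order_isomorphic :: "'a::linorder list \<Rightarrow> 'b::linorder list \<Rightarrow> bool" where
  "order_isomorphic u v \<longleftrightarrow> length u = length v \<and>
     (\<forall>i < length u. \<forall>j < length u.
        (u ! i < u ! j \<longleftrightarrow> v ! i < v ! j) \<and> (u ! i = u ! j \<longleftrightarrow> v ! i = v ! j))"

(* subseq ranges over the not necessarily contiguous subwords w_{i_1} ... w_{i_k}
   with i_1 < ... < i_k. *)
definition avoids :: "'a::linorder list \<Rightarrow> 'b::linorder list \<Rightarrow> bool" where
  "avoids w P \<longleftrightarrow> \<not> (\<exists>u. subseq u w \<and> order_isomorphic u P)"

definition inversion_seqs_avoiding :: "nat \<Rightarrow> nat list \<times> nat list \<Rightarrow> nat list set" where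
  "inversion_seqs_avoiding n p =
     {e. length e = n \<and> inversion_seq e \<and> avoids e (fst p) \<and> avoids e (snd p)}"

end

theory Submission
  imports Defs
begin

text \<open>
  Avoidance of 001 alone almost determines an inversion sequence.  As long as the entries are
  pairwise distinct, the bound \<open>e ! i \<le> i\<close> forces \<open>e ! i = i\<close>.  The first repeated entry is some
  value at most \<open>k\<close>, where \<open>0, 1, \<dots>, k\<close> is the staircase read so far; from then on every entry is
  dominated by an earlier repetition, so it is again a value of the staircase and hence itself a
  repetition, which dominates everything to its right.  Thus the sequences are exactly a staircase
  \<open>0, 1, \<dots>, k\<close> followed by a weakly decreasing tail with values in \<open>{0..k}\<close>
  (lemma \<open>avoids_001_iff_staircase\<close>).

  The second pattern then cuts the freedom down to one parameter:

  \<^item> an entry \<open>t < k\<close> of the tail gives an occurrence \<open>t, k, t\<close> of 010, so the tail is constantly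
    \<open>k\<close>;
  \<^item> an entry \<open>t > 0\<close> of the tail gives an occurrence \<open>0, t, t\<close> of 011, so the tail is constantly
    \<open>0\<close>;
  \<^item> a staircase with \<open>k \<ge> 2\<close> contains 012, so \<open>k \<le> 1\<close> and the sequence is \<open>0\<close>, then a block
    of ones, then zeros.

  In the first two cases the parameter is \<open>k\<close>, in the third it is the number of ones; it ranges
  over \<open>{..<n}\<close> each time, and distinct parameters give distinct sequences.
\<close>

section \<open>Occurrences of patterns of length three\<close>

lemma subseq_Cons_iff_nth:
  "subseq (x # xs) w \<longleftrightarrow> (\<exists>i<length w. w ! i = x \<and> subseq xs (drop (Suc i) w))"
proof
  assume "subseq (x # xs) w"
  then obtain us vs where w: "w = us @ x # vs" and "subseq xs vs"
    by (auto dest: list_emb_ConsD)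
  then show "\<exists>i<length w. w ! i = x \<and> subseq xs (drop (Suc i) w)"
    by (intro exI[of _ "length us"]) auto
next
  assume "\<exists>i<length w. w ! i = x \<and> subseq xs (drop (Suc i) w)"
  then obtain i where i: "i < length w" "w ! i = x" "subseq xs (drop (Suc i) w)"
    by blast
  then have "subseq (x # xs) (drop i w)"
    by (simp add: Cons_nth_drop_Suc[symmetric])
  then show "subseq (x # xs) w"
    by (meson subseq_order.order_trans suffix_drop suffix_imp_subseq)
qed

lemma subseq_triple_iff_nth:
  "subseq [a, b, c] w \<longleftrightarrow>
     (\<exists>i j l. i < j \<and> j < l \<and> l < length w \<and> w ! i = a \<and> w ! j = b \<and> w ! l = c)"
proof
  assume "subseq [a, b, c] w"
  then obtain i j l where "i < length w" "w ! i = a"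
    and "j < length (drop (Suc i) w)" "drop (Suc i) w ! j = b"
    and "l < length (drop (Suc j) (drop (Suc i) w))" "drop (Suc j) (drop (Suc i) w) ! l = c"
    by (auto simp only: subseq_Cons_iff_nth)
  then show "\<exists>i j l. i < j \<and> j < l \<and> l < length w \<and> w ! i = a \<and> w ! j = b \<and> w ! l = c"
    by (intro exI[of _ i] exI[of _ "Suc i + j"] exI[of _ "Suc i + Suc j + l"])
       (auto simp: algebra_simps)
next
  assume "\<exists>i j l. i < j \<and> j < l \<and> l < length w \<and> w ! i = a \<and> w ! j = b \<and> w ! l = c"
  then obtain i j l where ijl: "i < j" "j < l" "l < length w" "w ! i = a" "w ! j = b" "w ! l = c"
    by blast
  then have "subseq [c] (drop (Suc j) w)"
    unfolding subseq_Cons_iff_nth[of c] by (intro exI[of _ "l - Suc j"]) auto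
  then have "subseq [b, c] (drop (Suc i) w)"
    unfolding subseq_Cons_iff_nth[of b] using ijl by (intro exI[of _ "j - Suc i"]) auto
  then show "subseq [a, b, c] w"
    unfolding subseq_Cons_iff_nth[of a] using ijl by (intro exI[of _ i]) auto
qed

lemma avoids_triple_iff_nth:
  "avoids w [x, y, z] \<longleftrightarrow>
     (\<forall>i j l. i < j \<longrightarrow> j < l \<longrightarrow> l < length w \<longrightarrow>
        \<not> order_isomorphic [w ! i, w ! j, w ! l] [x, y, z])"
proof -
  have "\<exists>a b c. u = [a, b, c]" if "order_isomorphic u [x, y, z]" for u :: "'a list"
    using that by (auto simp: order_isomorphic_def numeral_3_eq_3 length_Suc_conv)
  then have "(\<exists>u. subseq u w \<and> order_isomorphic u [x, y, z]) \<longleftrightarrow>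
      (\<exists>a b c. subseq [a, b, c] w \<and> order_isomorphic [a, b, c] [x, y, z])"
    by metis
  then show ?thesis
    unfolding avoids_def subseq_triple_iff_nth by blast
qed

lemma order_isomorphic_triple_iff:
  "order_isomorphic [a, b, c] [x, y, z] \<longleftrightarrow>
     (a < b \<longleftrightarrow> x < y) \<and> (a = b \<longleftrightarrow> x = y) \<and> (a < c \<longleftrightarrow> x < z) \<and> (a = c \<longleftrightarrow> x = z) \<and>
     (b < c \<longleftrightarrow> y < z) \<and> (b = c \<longleftrightarrow> y = z)"
  by (auto simp: order_isomorphic_def numeral_3_eq_3 All_less_Suc)

lemma avoids_001_iff:
  "avoids w [0, 0, 1 :: nat] \<longleftrightarrow>
     (\<forall>i j l. i < j \<longrightarrow> j < l \<longrightarrow> l < length w \<longrightarrow> w ! i = w ! j \<longrightarrow> w ! l \<le> w ! j)"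
proof -
  have "order_isomorphic [a, b, c] [0, 0, 1 :: nat] \<longleftrightarrow> a = b \<and> b < c" for a b c :: 'a
    unfolding order_isomorphic_triple_iff by auto
  then show ?thesis
    unfolding avoids_triple_iff_nth by (simp only: de_Morgan_conj not_less imp_conv_disj)
qed

lemma avoids_010_iff:
  "avoids w [0, 1, 0 :: nat] \<longleftrightarrow>
     (\<forall>i j l. i < j \<longrightarrow> j < l \<longrightarrow> l < length w \<longrightarrow> w ! i = w ! l \<longrightarrow> w ! j \<le> w ! i)"
proof -
  have "order_isomorphic [a, b, c] [0, 1, 0 :: nat] \<longleftrightarrow> a = c \<and> a < b" for a b c :: 'a
    unfolding order_isomorphic_triple_iff by auto
  then show ?thesis
    unfolding avoids_triple_iff_nth by (simp only: de_Morgan_conj not_less imp_conv_disj)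
qed

lemma avoids_011_iff:
  "avoids w [0, 1, 1 :: nat] \<longleftrightarrow>
     (\<forall>i j l. i < j \<longrightarrow> j < l \<longrightarrow> l < length w \<longrightarrow> w ! j = w ! l \<longrightarrow> w ! j \<le> w ! i)"
proof -
  have "order_isomorphic [a, b, c] [0, 1, 1 :: nat] \<longleftrightarrow> b = c \<and> a < b" for a b c :: 'a
    unfolding order_isomorphic_triple_iff by auto
  then show ?thesis
    unfolding avoids_triple_iff_nth by (simp only: de_Morgan_conj not_less imp_conv_disj)
qed

lemma avoids_012_iff:
  "avoids w [0, 1, 2 :: nat] \<longleftrightarrow>
     (\<forall>i j l. i < j \<longrightarrow> j < l \<longrightarrow> l < length w \<longrightarrow> w ! i < w ! j \<longrightarrow> w ! l \<le> w ! j)"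
proof -
  have "order_isomorphic [a, b, c] [0, 1, 2 :: nat] \<longleftrightarrow> a < b \<and> b < c" for a b c :: 'a
    unfolding order_isomorphic_triple_iff by auto
  then show ?thesis
    unfolding avoids_triple_iff_nth by (simp only: de_Morgan_conj not_less imp_conv_disj)
qed

section \<open>Inversion sequences avoiding 001\<close>

definition staircase_then_decreasing :: "nat \<Rightarrow> nat list \<Rightarrow> bool" where
  "staircase_then_decreasing k e \<longleftrightarrow>
     k < length e \<and> (\<forall>i\<le>k. e ! i = i) \<and> (\<forall>i. k < i \<longrightarrow> i < length e \<longrightarrow> e ! i \<le> k) \<and>
     (\<forall>i j. k < i \<longrightarrow> i < j \<longrightarrow> j < length e \<longrightarrow> e ! j \<le> e ! i)"

text \<open>
  From left to right, \<open>k\<close> is the end of the longest staircase.  A tail entry with value \<open>v \<le> k\<close>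
  repeats the staircase entry at index \<open>v\<close>, so by 001-avoidance nothing larger than \<open>v\<close> can
  follow it.  From right to left, an equality \<open>e ! i = e ! j\<close> with \<open>i < j\<close> puts \<open>j\<close> into the
  tail, which is decreasing.
\<close>

lemma avoids_001_iff_staircase:
  assumes "e \<noteq> []"
  shows "inversion_seq e \<and> avoids e [0, 0, 1 :: nat] \<longleftrightarrow> (\<exists>k. staircase_then_decreasing k e)"
proof (intro iffI; (elim conjE exE)?)
  assume inv: "inversion_seq e" and av: "avoids e [0, 0, 1 :: nat]"
  define S where "S = {k. k < length e \<and> (\<forall>i\<le>k. e ! i = i)}"
  define k where "k = Max S"
  have fin: "finite S"
    unfolding S_def by simp
  have "0 \<in> S"
    using inv assms by (auto simp: S_def inversion_seq_def)
  then have "k \<in> S"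
    unfolding k_def using fin by (intro Max_in) auto
  then have k: "k < length e" "\<And>i. i \<le> k \<Longrightarrow> e ! i = i"
    by (auto simp: S_def)
  have first: "e ! Suc k \<le> k" if "Suc k < length e"
  proof (rule ccontr)
    assume "\<not> e ! Suc k \<le> k"
    then have "e ! Suc k = Suc k"
      using inv that by (metis inversion_seq_def le_antisym not_less_eq_eq)
    then have "Suc k \<in> S"
      using k that by (auto simp: S_def le_Suc_eq)
    then show False
      using fin k_def by (metis Max_ge Suc_n_not_le_n)
  qed
  have dominates: "e ! j \<le> e ! i" if "k < i" "i < j" "j < length e" "e ! i \<le> k" for i j
  proof -
    have "e ! (e ! i) = e ! i"
      using k that by blast
    moreover have "e ! i < i"
      using that by linarith
    ultimately show ?thesis
      using av that unfolding avoids_001_iff by blast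
  qed
  have small: "e ! i \<le> k" if "k < i" "i < length e" for i
  proof (cases "i = Suc k")
    case True
    then show ?thesis using first that by simp
  next
    case False
    then have "e ! i \<le> e ! Suc k" "e ! Suc k \<le> k"
      using that first dominates[of "Suc k" i] by auto
    then show ?thesis by linarith
  qed
  show "\<exists>k. staircase_then_decreasing k e"
    unfolding staircase_then_decreasing_def using k small dominates by (intro exI[of _ k]) auto
next
  fix k
  assume sc: "staircase_then_decreasing k e"
  have "e ! i \<le> i" if "i < length e" for i
    using sc that unfolding staircase_then_decreasing_def
    by (cases "i \<le> k") (auto simp: not_le intro: le_trans less_imp_le)
  moreover have "e ! l \<le> e ! j" if "i < j" "j < l" "l < length e" "e ! i = e ! j" for i j l
  proof -
    have "k < j"
    proof (rule ccontr)
      assume "\<not> k < j"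
      then have "e ! i = i" "e ! j = j"
        using sc that unfolding staircase_then_decreasing_def by auto
      then show False using that by simp
    qed
    then show ?thesis
      using sc that unfolding staircase_then_decreasing_def by blast
  qed
  ultimately show "inversion_seq e \<and> avoids e [0, 0, 1 :: nat]"
    unfolding inversion_seq_def avoids_001_iff by blast
qed

section \<open>The effect of the second pattern\<close>

lemma staircase_avoids_010_iff:
  assumes sc: "staircase_then_decreasing k e"
  shows "avoids e [0, 1, 0 :: nat] \<longleftrightarrow> (\<forall>i. k < i \<longrightarrow> i < length e \<longrightarrow> e ! i = k)"
proof (intro iffI allI impI)
  fix i
  assume av: "avoids e [0, 1, 0 :: nat]" and i: "k < i" "i < length e"
  have le: "e ! i \<le> k" and st: "e ! (e ! i) = e ! i" "e ! k = k"
    using sc i unfolding staircase_then_decreasing_def by auto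
  show "e ! i = k"
  proof (rule ccontr)
    assume "e ! i \<noteq> k"
    then have "e ! i < k" using le by simp
    then have "e ! k \<le> e ! (e ! i)"
      using av i st unfolding avoids_010_iff by blast
    then show False using \<open>e ! i < k\<close> st by simp
  qed
next
  assume "\<forall>i. k < i \<longrightarrow> i < length e \<longrightarrow> e ! i = k"
  then have "e ! i = min i k" if "i < length e" for i
    using sc that unfolding staircase_then_decreasing_def by (cases "i \<le> k") auto
  then show "avoids e [0, 1, 0 :: nat]"
    unfolding avoids_010_iff by (auto simp: min_def split: if_splits)
qed

lemma staircase_avoids_011_iff:
  assumes sc: "staircase_then_decreasing k e"
  shows "avoids e [0, 1, 1 :: nat] \<longleftrightarrow> (\<forall>i. k < i \<longrightarrow> i < length e \<longrightarrow> e ! i = 0)"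
proof (intro iffI allI impI)
  fix i
  assume av: "avoids e [0, 1, 1 :: nat]" and i: "k < i" "i < length e"
  have le: "e ! i \<le> k" and st: "e ! (e ! i) = e ! i" "e ! 0 = 0"
    using sc i unfolding staircase_then_decreasing_def by auto
  show "e ! i = 0"
  proof (rule ccontr)
    assume "e ! i \<noteq> 0"
    moreover have "e ! i < i" using le i by simp
    ultimately have "e ! (e ! i) \<le> e ! 0"
      using av i st unfolding avoids_011_iff by blast
    then show False using \<open>e ! i \<noteq> 0\<close> st by simp
  qed
next
  assume "\<forall>i. k < i \<longrightarrow> i < length e \<longrightarrow> e ! i = 0"
  then have "e ! i = (if i \<le> k then i else 0)" if "i < length e" for i
    using sc that unfolding staircase_then_decreasing_def by (cases "i \<le> k") auto
  then show "avoids e [0, 1, 1 :: nat]"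
    unfolding avoids_011_iff by (auto split: if_splits)
qed

lemma staircase_avoids_012_iff:
  assumes sc: "staircase_then_decreasing k e"
  shows "avoids e [0, 1, 2 :: nat] \<longleftrightarrow> k \<le> 1"
proof
  assume av: "avoids e [0, 1, 2 :: nat]"
  show "k \<le> 1"
  proof (rule ccontr)
    assume "\<not> k \<le> 1"
    then have "e ! 0 = 0" "e ! 1 = 1" "e ! 2 = 2" "2 < length e"
      using sc unfolding staircase_then_decreasing_def by auto
    moreover have "(0::nat) < 1" "(1::nat) < 2" by simp_all
    ultimately have "e ! 2 \<le> e ! 1"
      using av unfolding avoids_012_iff by (metis zero_less_one)
    then show False
      using \<open>e ! 1 = 1\<close> \<open>e ! 2 = 2\<close> by simp
  qed
next
  assume k: "k \<le> 1"
  have "e ! i \<le> 1" if "i < length e" for i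
    using sc that k unfolding staircase_then_decreasing_def
    by (metis le_trans not_le)
  then show "avoids e [0, 1, 2 :: nat]"
    unfolding avoids_012_iff
    by (metis (no_types) One_nat_def Suc_leI le_trans less_nat_zero_code neq0_conv)
qed

text \<open>
  Here the parameter of the family is not \<open>k\<close>: all sequences with at least one 1 have \<open>k = 1\<close>,
  and \<open>m\<close> is the index of the last 1 (or 0 if there is none).
\<close>

lemma short_staircase_iff_block_of_ones:
  assumes "e \<noteq> []"
  shows "(\<exists>k\<le>1. staircase_then_decreasing k e) \<longleftrightarrow>
    (\<exists>m<length e. \<forall>i<length e. e ! i = (if 1 \<le> i \<and> i \<le> m then 1 else 0))"
proof
  assume "\<exists>k\<le>1. staircase_then_decreasing k e"
  then obtain k where k: "k \<le> 1" and sc: "staircase_then_decreasing k e"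
    by blast
  have zero: "e ! 0 = 0"
    using sc unfolding staircase_then_decreasing_def by auto
  have le1: "e ! i \<le> 1" if "i < length e" for i
    using sc that k unfolding staircase_then_decreasing_def
    by (metis le_trans not_le)
  have decr: "e ! j \<le> e ! i" if "1 \<le> i" "i < j" "j < length e" for i j
  proof (cases "k < i")
    case True
    then show ?thesis
      using sc that unfolding staircase_then_decreasing_def by blast
  next
    case False
    then have "i = 1" "k = 1" using k that by auto
    then have "e ! i = 1"
      using sc unfolding staircase_then_decreasing_def by auto
    then show ?thesis using le1 that by simp
  qed
  define S where "S = {i. i < length e \<and> (i = 0 \<or> e ! i = 1)}"
  define m where "m = Max S"
  have fin: "finite S"
    unfolding S_def by simp
  have "0 \<in> S"
    using assms by (auto simp: S_def)
  then have m: "m \<in> S"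
    unfolding m_def using fin by (intro Max_in) auto
  have "e ! i = (if 1 \<le> i \<and> i \<le> m then 1 else 0)" if i: "i < length e" for i
  proof (cases "1 \<le> i \<and> i \<le> m")
    case True
    then have "e ! m = 1" "m < length e"
      using m by (auto simp: S_def)
    then have "1 \<le> e ! i"
      using True decr[of i m] by (cases "i = m") auto
    then show ?thesis
      using True le1[OF i] by simp
  next
    case False
    show ?thesis
    proof (cases "i = 0")
      case True
      then show ?thesis using zero by simp
    next
      case nz: False
      then have "i \<notin> S"
        using False fin m_def by (metis Max_ge Suc_leI neq0_conv One_nat_def)
      then have "e ! i = 0"
        using i nz le1[OF i] by (auto simp: S_def)
      then show ?thesis using False by simp
    qed
  qed
  then show "\<exists>m<length e. \<forall>i<length e. e ! i = (if 1 \<le> i \<and> i \<le> m then 1 else 0)"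
    using m by (auto simp: S_def)
next
  assume "\<exists>m<length e. \<forall>i<length e. e ! i = (if 1 \<le> i \<and> i \<le> m then 1 else 0)"
  then obtain m where m: "m < length e"
    and e: "\<And>i. i < length e \<Longrightarrow> e ! i = (if 1 \<le> i \<and> i \<le> m then 1 else 0)"
    by blast
  have "e ! 0 = 0"
    using e[of 0] assms by simp
  have "staircase_then_decreasing (min m 1) e"
    unfolding staircase_then_decreasing_def using m e \<open>e ! 0 = 0\<close>
    by (auto simp: min_def le_Suc_eq)
  then show "\<exists>k\<le>1. staircase_then_decreasing k e"
    by (intro exI[of _ "min m 1"]) simp
qed

section \<open>Counting\<close>

text \<open>
  In each of the three families, the sequences with parameters \<open>k < l\<close> already differ at index \<open>l\<close>.
\<close>

lemma card_lists_in_family: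
  assumes "\<And>k l. k < l \<Longrightarrow> l < n \<Longrightarrow> f k l \<noteq> f l l"
  shows "card {e. length e = n \<and> (\<exists>k<n. \<forall>i<n. e ! i = f k i)} = n"
proof -
  have "{e. length e = n \<and> (\<exists>k<n. \<forall>i<n. e ! i = f k i)} = (\<lambda>k. map (f k) [0..<n]) ` {..<n}"
    by (auto simp: image_iff intro!: nth_equalityI)
  moreover have "inj_on (\<lambda>k. map (f k) [0..<n]) {..<n}"
  proof (rule linorder_inj_onI)
    fix k l
    assume "k < l" "l \<in> {..<n}"
    then have "map (f k) [0..<n] ! l \<noteq> map (f l) [0..<n] ! l"
      using assms by simp
    then show "map (f k) [0..<n] \<noteq> map (f l) [0..<n]"
      by metis
  qed auto
  ultimately show ?thesis
    by (simp add: card_image)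
qed

lemma inversion_seqs_avoiding_001_eq:
  assumes "n \<ge> 1"
  shows "inversion_seqs_avoiding n ([0, 0, 1], P) =
    {e. length e = n \<and> (\<exists>k. staircase_then_decreasing k e \<and> avoids e P)}"
proof -
  have "inversion_seq e \<and> avoids e [0, 0, 1 :: nat] \<and> avoids e P \<longleftrightarrow>
      (\<exists>k. staircase_then_decreasing k e \<and> avoids e P)" if "length e = n" for e
  proof -
    have "e \<noteq> []" using that assms by auto
    then show ?thesis using avoids_001_iff_staircase[of e] by blast
  qed
  then show ?thesis
    unfolding inversion_seqs_avoiding_def fst_conv snd_conv by blast
qed

lemma card_inversion_seqs_avoiding_001_010:
  assumes "n \<ge> 1"
  shows "card (inversion_seqs_avoiding n ([0, 0, 1], [0, 1, 0])) = n"
proof -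
  have "(\<exists>k. staircase_then_decreasing k e \<and> avoids e [0, 1, 0 :: nat]) \<longleftrightarrow>
      (\<exists>k<n. \<forall>i<n. e ! i = min i k)" if n: "length e = n" for e
  proof
    assume "\<exists>k. staircase_then_decreasing k e \<and> avoids e [0, 1, 0 :: nat]"
    then obtain k where "staircase_then_decreasing k e" "\<forall>i. k < i \<longrightarrow> i < n \<longrightarrow> e ! i = k"
      using staircase_avoids_010_iff n by blast
    then show "\<exists>k<n. \<forall>i<n. e ! i = min i k"
      using n unfolding staircase_then_decreasing_def
      by (intro exI[of _ k]) (auto simp: min_def)
  next
    assume "\<exists>k<n. \<forall>i<n. e ! i = min i k"
    then obtain k where k: "k < n" "\<And>i. i < n \<Longrightarrow> e ! i = min i k"
      by blast
    then have "staircase_then_decreasing k e"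
      using n unfolding staircase_then_decreasing_def by auto
    then show "\<exists>k. staircase_then_decreasing k e \<and> avoids e [0, 1, 0 :: nat]"
      using k n staircase_avoids_010_iff by (intro exI[of _ k]) auto
  qed
  then have "inversion_seqs_avoiding n ([0, 0, 1], [0, 1, 0]) =
      {e. length e = n \<and> (\<exists>k<n. \<forall>i<n. e ! i = min i k)}"
    unfolding inversion_seqs_avoiding_001_eq[OF assms] by blast
  moreover have "card \<dots> = n"
    by (rule card_lists_in_family) auto
  ultimately show ?thesis by simp
qed

lemma card_inversion_seqs_avoiding_001_011:
  assumes "n \<ge> 1"
  shows "card (inversion_seqs_avoiding n ([0, 0, 1], [0, 1, 1])) = n"
proof -
  have "(\<exists>k. staircase_then_decreasing k e \<and> avoids e [0, 1, 1 :: nat]) \<longleftrightarrow>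
      (\<exists>k<n. \<forall>i<n. e ! i = (if i \<le> k then i else 0))" if n: "length e = n" for e
  proof
    assume "\<exists>k. staircase_then_decreasing k e \<and> avoids e [0, 1, 1 :: nat]"
    then obtain k where "staircase_then_decreasing k e" "\<forall>i. k < i \<longrightarrow> i < n \<longrightarrow> e ! i = 0"
      using staircase_avoids_011_iff n by blast
    then show "\<exists>k<n. \<forall>i<n. e ! i = (if i \<le> k then i else 0)"
      using n unfolding staircase_then_decreasing_def by (intro exI[of _ k]) auto
  next
    assume "\<exists>k<n. \<forall>i<n. e ! i = (if i \<le> k then i else 0)"
    then obtain k where k: "k < n" "\<And>i. i < n \<Longrightarrow> e ! i = (if i \<le> k then i else 0)"
      by blast
    then have "staircase_then_decreasing k e"
      using n unfolding staircase_then_decreasing_def by auto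
    then show "\<exists>k. staircase_then_decreasing k e \<and> avoids e [0, 1, 1 :: nat]"
      using k n staircase_avoids_011_iff by (intro exI[of _ k]) auto
  qed
  then have "inversion_seqs_avoiding n ([0, 0, 1], [0, 1, 1]) =
      {e. length e = n \<and> (\<exists>k<n. \<forall>i<n. e ! i = (if i \<le> k then i else 0))}"
    unfolding inversion_seqs_avoiding_001_eq[OF assms] by blast
  moreover have "card \<dots> = n"
    by (rule card_lists_in_family) auto
  ultimately show ?thesis by simp
qed

lemma card_inversion_seqs_avoiding_001_012:
  assumes "n \<ge> 1"
  shows "card (inversion_seqs_avoiding n ([0, 0, 1], [0, 1, 2])) = n"
proof -
  have "(\<exists>k. staircase_then_decreasing k e \<and> avoids e [0, 1, 2 :: nat]) \<longleftrightarrow>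
      (\<exists>m<n. \<forall>i<n. e ! i = (if 1 \<le> i \<and> i \<le> m then 1 else 0))" if n: "length e = n" for e
  proof -
    have "e \<noteq> []" using n assms by auto
    have "(\<exists>k. staircase_then_decreasing k e \<and> avoids e [0, 1, 2 :: nat]) \<longleftrightarrow>
        (\<exists>k\<le>1. staircase_then_decreasing k e)"
      using staircase_avoids_012_iff by blast
    then show ?thesis
      using short_staircase_iff_block_of_ones[OF \<open>e \<noteq> []\<close>] unfolding n by (rule trans)
  qed
  then have "inversion_seqs_avoiding n ([0, 0, 1], [0, 1, 2]) =
      {e. length e = n \<and> (\<exists>m<n. \<forall>i<n. e ! i = (if 1 \<le> i \<and> i \<le> m then 1 else 0))}"
    unfolding inversion_seqs_avoiding_001_eq[OF assms] by blast
  moreover have "card \<dots> = n"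
    by (rule card_lists_in_family) auto
  ultimately show ?thesis by simp
qed

theorem theorem2p1:
  fixes n :: nat and p :: "nat list \<times> nat list"
  assumes "n \<ge> 1"
    and "p \<in> {([0,0,1],[0,1,0]), ([0,0,1],[0,1,1]), ([0,0,1],[0,1,2])}"
  shows "card (inversion_seqs_avoiding n p) = n"
  using assms card_inversion_seqs_avoiding_001_010 card_inversion_seqs_avoiding_001_011
    card_inversion_seqs_avoiding_001_012
  by auto

end
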